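(* Let $\lambda\in\left[0,\frac{2}{\sqrt{3}}\right]$. Then there exists a set of cardinality of the continuum of vectors $\mathbf{v}\in\mathbb{R}^2$ whose sequence of best approximations $(q_n,\mathbf{p}_n)_{n\geqslant 0}$ is infinite and satisfies $$\lim_{n\to\infty}\frac{1}{\pi}V_{n+1}=\lim_{n\to\infty} q_{n+1}\,|q_n\mathbf{v}-\mathbf{p}_n|^2=\lambda .$$
   Context: For $x\in\mathbb{R}$, $\|x\|$ is the distance from $x$ to the nearest integer, and $|\cdot|$ is the Euclidean norm on $\mathbb{R}^2$. For $\mathbf{v}=(v_1,v_2)\in\mathbb{R}^2$, the sequence of best approximations (Euclidean norm) is defined by: $q_0=1$; $q_{n+1}=\min\{q\in\mathbb{N}: \sqrt{\|qv_1\|^2+\|qv_2\|^2}<\sqrt{\|q_nv_1\|^2+\|q_nv_2\|^2}\}$ (as long as this set is nonempty); and $\mathbf{p}_n=(p_{n,1},p_{n,2})\in\mathbb{Z}^2$ with $|q_nv_1-p_{n,1}|=\|q_nv_1\|$, $|q_nv_2-p_{n,2}|=\|q_nv_2\|$. Thus $|q_n\mathbf{v}-\mathbf{p}_n|=\sqrt{\|q_nv_1\|^2+\|q_nv_2\|^2}$ does not depend on the choice of $\mathbf{p}_n$. For $n\geqslant 1$ set $R_n=|q_{n-1}\mathbf{v}-\mathbf{p}_{n-1}|$ and $V_n=\pi q_n R_n^2$ (the volume of the cylinder $\{(q,\mathbf{p})\in\mathbb{R}\times\mathbb{R}^2: 0\leqslant q\leqslant q_n,\ |q\mathbf{v}-\mathbf{p}|\leqslant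 R_n\}$). *)

theory Defs
  imports "HOL-Analysis.Analysis" "HOL-Library.Equipollence"
begin

abbreviation dist_int :: "real \<Rightarrow> real" where
  "dist_int x \<equiv> infdist x \<int>"

definition approx_err :: "real ^ 2 \<Rightarrow> nat \<Rightarrow> real" where
  "approx_err v q = sqrt ((dist_int (real q * v $ 1))\<^sup>2 + (dist_int (real q * v $ 2))\<^sup>2)"

text \<open>Denominators are positive: admitting \<open>q = 0\<close>, whose error is 0, would make the
  recursion for the best approximations degenerate.\<close>

definition better_denoms :: "real ^ 2 \<Rightarrow> nat \<Rightarrow> nat set" where
  "better_denoms v Q = {q. 0 < q \<and> approx_err v q < approx_err v Q}"

text \<open>The value \<open>best_denom v (Suc n)\<close> is meaningful only as long as the set of better
  denominators is nonempty; \<open>infinite_best_approx v\<close> says that this never fails.\<close>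

primrec best_denom :: "real ^ 2 \<Rightarrow> nat \<Rightarrow> nat" where
  "best_denom v 0 = 1"
| "best_denom v (Suc n) = (LEAST q. q \<in> better_denoms v (best_denom v n))"

definition infinite_best_approx :: "real ^ 2 \<Rightarrow> bool" where
  "infinite_best_approx v \<longleftrightarrow> (\<forall>n. better_denoms v (best_denom v n) \<noteq> {})"

text \<open>The numerators need not be unique, since a coordinate may lie halfway between two
  integers, so they are described by a predicate.\<close>

definition best_numerators :: "real ^ 2 \<Rightarrow> (nat \<Rightarrow> int ^ 2) \<Rightarrow> bool" where
  "best_numerators v p \<longleftrightarrow>
     (\<forall>n i. \<bar>real (best_denom v n) * v $ i - of_int (p n $ i)\<bar>
            = dist_int (real (best_denom v n) * v $ i))"

definition best_dist :: "real ^ 2 \<Rightarrow> (nat \<Rightarrow> int ^ 2) \<Rightarrow> nat \<Rightarrow> real" where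
  "best_dist v p n = norm (real (best_denom v n) *\<^sub>R v - (\<chi> i. of_int (p n $ i)))"

text \<open>Both of the following are used for \<open>n \<ge> 1\<close> only.\<close>

definition cyl_radius :: "real ^ 2 \<Rightarrow> (nat \<Rightarrow> int ^ 2) \<Rightarrow> nat \<Rightarrow> real" where
  "cyl_radius v p n = best_dist v p (n - 1)"

definition cyl_volume :: "real ^ 2 \<Rightarrow> (nat \<Rightarrow> int ^ 2) \<Rightarrow> nat \<Rightarrow> real" where
  "cyl_volume v p n = pi * real (best_denom v n) * (cyl_radius v p n)\<^sup>2"

lemma dist_int_eq_round: "dist_int x = \<bar>x - of_int (round x)\<bar>"
proof (rule antisym)
  have ne: "(\<int> :: real set) \<noteq> {}" using Ints_0 by blast
  show "dist_int x \<le> \<bar>x - of_int (round x)\<bar>"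
    using infdist_le[of "of_int (round x)" "\<int>" x] by (simp add: dist_real_def)
  show "\<bar>x - of_int (round x)\<bar> \<le> dist_int x"
    unfolding infdist_notempty[OF ne]
  proof (rule cINF_greatest[OF ne])
    fix a :: real assume "a \<in> \<int>"
    then obtain m where "a = of_int m" by (auto elim: Ints_cases)
    then show "\<bar>x - of_int (round x)\<bar> \<le> dist x a"
      using round_diff_minimal[of x m] by (simp add: dist_real_def)
  qed
qed

lemma best_numerators_exist: "\<exists>p. best_numerators v p"
  by (rule exI[of _ "\<lambda>n. \<chi> i. round (real (best_denom v n) * v $ i)"])
     (simp add: best_numerators_def dist_int_eq_round)

lemma best_dist_eq_approx_err:
  "best_numerators v p \<Longrightarrow> best_dist v p n = approx_err v (best_denom v n)"
  by (simp add: best_numerators_def best_dist_def approx_err_def norm_vec_def L2_set_def sum_2)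

end

theory Submission
  imports Defs "HOL-Number_Theory.Cong" "HOL-Real_Asymp.Real_Asymp"
begin

text \<open>
  The vectors are limits of rational points \<open>w\<^sub>n = (p\<^sub>n / q\<^sub>n, P\<^sub>n / q\<^sub>n)\<close> with
  \<open>p\<^sub>n\<^sub>+\<^sub>1 q\<^sub>n - p\<^sub>n q\<^sub>n\<^sub>+\<^sub>1 = 1\<close>. Put \<open>Q = q\<^sub>n\<^sub>+\<^sub>1\<close> and \<open>D = P\<^sub>n\<^sub>+\<^sub>1 q\<^sub>n - P\<^sub>n Q\<close>. The lattice
  \<open>\<int> w\<^sub>n\<^sub>+\<^sub>1 + \<int>\<^sup>2\<close> is spanned by \<open>(1/Q, D/Q)\<close>, which comes from the denominator \<open>q\<^sub>n\<close>, and
  \<open>(0, 1)\<close>. If \<open>Q\<close> is about \<open>(1 + D\<^sup>2) / \<lambda>\<close> with \<open>\<lambda> < 2 / \<surd>3\<close>, and \<open>D Q / (1 + D\<^sup>2)\<close> is about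
  half an odd integer, then the first vector is, up to sign, the unique shortest one, and \<open>Q\<close>
  times its squared length is about \<open>\<lambda>\<close>; the endpoints of the range of \<open>\<lambda>\<close> are reached by letting
  \<open>\<lambda>\<close> vary with \<open>n\<close>. Taking \<open>D\<close> large makes \<open>w\<^sub>n\<^sub>+\<^sub>1\<close> so close to \<open>w\<^sub>n\<close> that all earlier strict
  inequalities survive. The only competing denominator below \<open>Q\<close> is \<open>Q - q\<^sub>n\<close>; if it does occur as
  a best approximation, this is harmless because it is asymptotic to \<open>Q\<close>. The sign of each \<open>D\<close>
  can be prescribed and is read off the limit as the side of \<open>P\<^sub>n / q\<^sub>n\<close> on which its second
  coordinate lies, which yields continuum many vectors.
\<close>

subsection \<open>Cantor schemes\<close>

locale Cantor_scheme =
  fixes valid :: "'s \<Rightarrow> bool" and region :: "'s \<Rightarrow> 'a::heine_borel set"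
    and refines :: "nat \<Rightarrow> bool \<Rightarrow> 's \<Rightarrow> 's \<Rightarrow> bool" and root :: 's
  assumes valid_root: "valid root"
    and exists_refinement: "valid s \<Longrightarrow> \<exists>t. valid t \<and> refines n b s t"
    and compact_region: "valid s \<Longrightarrow> compact (region s)"
    and region_nonempty: "valid s \<Longrightarrow> region s \<noteq> {}"
    and region_subset: "refines n b s t \<Longrightarrow> region t \<subseteq> region s"
    and region_disjoint: "refines n True s t \<Longrightarrow> refines n False s u \<Longrightarrow> region t \<inter> region u = {}"
begin

primrec branch :: "nat set \<Rightarrow> nat \<Rightarrow> 's" where
  "branch A 0 = root"
| "branch A (Suc n) = (SOME t. valid t \<and> refines n (n \<in> A) (branch A n) t)"

lemma valid_branch: "valid (branch A n)"
proof (induction n)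
  case 0
  show ?case by (simp add: valid_root)
next
  case (Suc n)
  from someI_ex[OF exists_refinement[OF Suc]] show ?case by simp
qed

lemma branch_refines: "refines n (n \<in> A) (branch A n) (branch A (Suc n))"
  using someI_ex[OF exists_refinement[OF valid_branch]] by simp

definition branch_point :: "nat set \<Rightarrow> 'a" where
  "branch_point A = (SOME x. \<forall>n. x \<in> region (branch A n))"

lemma branch_point_mem: "branch_point A \<in> region (branch A n)"
proof -
  have "region (branch A (Suc m)) \<subseteq> region (branch A m)" for m
    using branch_refines by (rule region_subset)
  then have "region (branch A n) \<subseteq> region (branch A m)" if "m \<le> n" for m n
    using that by (rule lift_Suc_antimono_le)
  then have "\<Inter>(range (\<lambda>m. region (branch A m))) \<noteq> {}"
    by (intro compact_nest compact_region region_nonempty valid_branch)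
  then have "\<exists>x. \<forall>m. x \<in> region (branch A m)" by blast
  then show ?thesis unfolding branch_point_def by (rule someI2_ex) blast
qed

lemma inj_branch_point: "inj branch_point"
proof (rule injI)
  fix A B assume eq: "branch_point A = branch_point B"
  have mem_transfer: "n \<in> B"
    if "n \<in> A" "branch A n = branch B n" "branch_point A = branch_point B" for A B n
  proof (rule ccontr)
    assume "n \<notin> B"
    then have "region (branch A (Suc n)) \<inter> region (branch B (Suc n)) = {}"
      using branch_refines[of n A] branch_refines[of n B] that(1,2)
      by (intro region_disjoint[of n "branch A n"]) simp_all
    then show False
      using branch_point_mem[of A "Suc n"] branch_point_mem[of B "Suc n"] that(3) by auto
  qed
  have branch_eq: "branch A n = branch B n" for n
  proof (induction n)
    case 0
    show ?case by simp
  next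
    case (Suc n)
    then have "n \<in> A \<longleftrightarrow> n \<in> B" using mem_transfer[of n A B] mem_transfer[of n B A] eq by auto
    with Suc show ?case by simp
  qed
  show "A = B"
    using mem_transfer[OF _ branch_eq eq] mem_transfer[OF _ branch_eq[symmetric] eq[symmetric]]
    by blast
qed

lemma range_branch_point_eqpoll: "range branch_point \<approx> (UNIV :: real set)"
  using inj_on_image_eqpoll_self[OF inj_branch_point] nat_sets_eqpoll_reals by (rule eqpoll_trans)

end

subsection \<open>A planar lattice with a prescribed shortest vector\<close>

lemma dist_int_le: "dist_int x \<le> \<bar>x - of_int m\<bar>"
  using infdist_le[of "of_int m" "\<int>" x] by (simp add: dist_real_def)

lemma dist_int_sq_le: "(dist_int x)\<^sup>2 \<le> (x - of_int m)\<^sup>2"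
  using dist_int_le by (metis infdist_nonneg power2_abs power_mono)

lemma dist_int_le_half: "dist_int x \<le> 1 / 2"
  using of_int_round_abs_le[of x] by (simp add: dist_int_eq_round abs_minus_commute)

lemma dist_int_add_of_int: "dist_int (x + of_int m) = dist_int x"
proof -
  have "dist_int (y + of_int k) \<le> dist_int y" for y k
    using dist_int_le[of "y + of_int k" "round y + k"] by (simp add: dist_int_eq_round[of y])
  from this[of x m] this[of "x + of_int m" "- m"] show ?thesis by simp
qed

lemma one_less_norm_sq_lattice_vector:
  fixes \<theta> t :: real and i j :: int
  assumes norm_gt_1: "1 < (dist_int \<theta>)\<^sup>2 + t\<^sup>2" and ij_notin: "(i, j) \<notin> {(0, 0), (1, 0), (-1, 0)}"
  shows "1 < (i + j * \<theta>)\<^sup>2 + (j * t)\<^sup>2"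
proof -
  have four_le: "4 \<le> (real_of_int m)\<^sup>2" if "2 \<le> \<bar>m\<bar>" for m
    using power_mono[of 2 "\<bar>real_of_int m\<bar>" 2] that by simp
  consider (zero) "j = 0" | (unit) "j = 1 \<or> j = -1" | (large) "2 \<le> \<bar>j\<bar>" by linarith
  then show ?thesis
  proof cases
    case zero
    then have "2 \<le> \<bar>i\<bar>" using ij_notin by auto
    then show ?thesis using four_le[of i] zero by simp
  next
    case unit
    then have "(i + j * \<theta>)\<^sup>2 = (\<theta> - of_int (- (j * i)))\<^sup>2" by (auto simp: power2_commute add.commute)
    then have "(dist_int \<theta>)\<^sup>2 \<le> (i + j * \<theta>)\<^sup>2" using dist_int_sq_le by metis
    moreover have "(j * t)\<^sup>2 = t\<^sup>2" using unit by auto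
    ultimately show ?thesis using norm_gt_1 by linarith
  next
    case large
    have "(dist_int \<theta>)\<^sup>2 \<le> (1 / 2)\<^sup>2" by (intro power_mono dist_int_le_half infdist_nonneg)
    then have "1 < 4 * t\<^sup>2" using norm_gt_1 by (simp add: power_divide)
    also have "\<dots> \<le> (j * t)\<^sup>2"
      unfolding power_mult_distrib using four_le[OF large] by (intro mult_right_mono) auto
    finally show ?thesis using zero_le_power2[of "i + j * \<theta>"] by linarith
  qed
qed

text \<open>Up to sign, \<open>(1, D)\<close> is the unique shortest nonzero vector of the lattice spanned by \<open>(1, D)\<close>
  and \<open>(0, Q)\<close>.\<close>

definition unique_shortest :: "real \<Rightarrow> real \<Rightarrow> bool" where
  "unique_shortest D Q \<longleftrightarrow> (\<forall>i j :: int. (i, j) \<notin> {(0, 0), (1, 0), (-1, 0)} \<longrightarrow>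
     1 + D\<^sup>2 < (of_int i)\<^sup>2 + (of_int i * D + of_int j * Q)\<^sup>2)"

lemma unique_shortestI:
  assumes "1 < (dist_int (D * Q / (1 + D\<^sup>2)))\<^sup>2 + (Q / (1 + D\<^sup>2))\<^sup>2"
  shows "unique_shortest D Q"
  unfolding unique_shortest_def
proof (intro allI impI)
  fix i j :: int assume ij_notin: "(i, j) \<notin> {(0, 0), (1, 0), (-1, 0)}"
  define M where "M = 1 + D\<^sup>2"
  have M_pos: "0 < M" unfolding M_def by (simp add: add_pos_nonneg)
  have "M * 1 < M * ((i + j * (D * Q / M))\<^sup>2 + (j * (Q / M))\<^sup>2)"
    using one_less_norm_sq_lattice_vector[OF assms ij_notin] M_pos
    by (intro mult_strict_left_mono) (simp_all add: M_def)
  also have "\<dots> = M * i\<^sup>2 + 2 * i * j * D * Q + j\<^sup>2 * Q\<^sup>2 * ((1 + D\<^sup>2) / M)"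
    using M_pos by (simp add: power2_eq_square field_simps)
  also have "(1 + D\<^sup>2) / M = 1" using M_pos by (simp add: M_def)
  finally show "1 + D\<^sup>2 < (of_int i)\<^sup>2 + (of_int i * D + of_int j * Q)\<^sup>2"
    unfolding M_def by (simp add: power2_eq_square algebra_simps)
qed

lemma unique_shortest_abs:
  assumes "unique_shortest \<bar>D\<bar> Q"
  shows "unique_shortest D Q"
  unfolding unique_shortest_def
proof (intro allI impI)
  fix i j :: int assume ij_notin: "(i, j) \<notin> {(0, 0), (1, 0), (-1, 0)}"
  show "1 + D\<^sup>2 < (of_int i)\<^sup>2 + (of_int i * D + of_int j * Q)\<^sup>2"
  proof (cases "0 \<le> D")
    case True
    then show ?thesis using assms ij_notin by (simp add: unique_shortest_def)
  next
    case False
    have "(- i, j) \<notin> {(0, 0), (1, 0), (-1, 0)}" using ij_notin by auto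
    from assms[unfolded unique_shortest_def, rule_format, OF this]
    show ?thesis using False by simp
  qed
qed

subsection \<open>Choice of the denominator\<close>

lemma exists_cong_between:
  fixes q r :: int and T :: real
  assumes "0 < q"
  obtains Q :: int where "[Q = r] (mod q)" "T \<le> Q" "Q < T + q"
proof
  let ?Q = "\<lceil>T\<rceil> + (r - \<lceil>T\<rceil>) mod q"
  show "[?Q = r] (mod q)" by (simp add: cong_def mod_simps)
  have "0 \<le> (r - \<lceil>T\<rceil>) mod q" "(r - \<lceil>T\<rceil>) mod q \<le> q - 1" using assms by (auto simp: pos_mod_bound)
  then show "T \<le> real_of_int ?Q" "real_of_int ?Q < T + q" by linarith+
qed

lemma limits_if_near_half_integers:
  fixes Q :: "real \<Rightarrow> int" and c :: real
  defines "y \<equiv> \<lambda>x. x * of_int (Q x) / (1 + x\<^sup>2) - (of_int \<lfloor>x / c\<rfloor> + 1 / 2)"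
  assumes c_pos: "0 < c" and y_lim: "(y \<longlongrightarrow> 0) at_top"
  shows "((\<lambda>x. Q x / (1 + x\<^sup>2)) \<longlongrightarrow> 1 / c) at_top"
    and "((\<lambda>x. dist_int (x * of_int (Q x) / (1 + x\<^sup>2))) \<longlongrightarrow> 1 / 2) at_top"
proof -
  have "((\<lambda>x. \<lfloor>x / c\<rfloor> / x) \<longlongrightarrow> inverse c) at_top" using c_pos by real_asymp
  moreover have "((\<lambda>x. (1 / 2 + y x) / x) \<longlongrightarrow> 0) at_top"
    by (rule tendsto_divide_0[OF tendsto_add[OF tendsto_const y_lim]])
      (rule filterlim_at_top_imp_at_infinity[OF filterlim_ident])
  ultimately have "((\<lambda>x. \<lfloor>x / c\<rfloor> / x + (1 / 2 + y x) / x) \<longlongrightarrow> 1 / c) at_top"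
    using tendsto_add by (fastforce simp: inverse_eq_divide)
  moreover have "\<forall>\<^sub>F x in at_top. \<lfloor>x / c\<rfloor> / x + (1 / 2 + y x) / x = Q x / (1 + x\<^sup>2)"
    using eventually_gt_at_top[of 0]
    by eventually_elim (simp add: y_def flip: add_divide_distrib)
  ultimately show "((\<lambda>x. Q x / (1 + x\<^sup>2)) \<longlongrightarrow> 1 / c) at_top"
    by (rule Lim_transform_eventually)
  have "((\<lambda>x. dist_int (1 / 2 + y x)) \<longlongrightarrow> dist_int (1 / 2 + 0)) at_top"
    by (intro tendsto_intros y_lim)
  moreover have "dist_int (1 / 2 + 0) = 1 / 2" by (simp add: dist_int_eq_round round_def)
  moreover have "dist_int (x * of_int (Q x) / (1 + x\<^sup>2)) = dist_int (1 / 2 + y x)" for x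
    using dist_int_add_of_int[of "1 / 2 + y x" "\<lfloor>x / c\<rfloor>"] by (simp add: y_def)
  ultimately show "((\<lambda>x. dist_int (x * of_int (Q x) / (1 + x\<^sup>2))) \<longlongrightarrow> 1 / 2) at_top"
    by (simp only:)
qed

lemma exists_cong_denominators:
  fixes q r :: int and c :: real
  assumes q_pos: "0 < q" and c_pos: "0 < c"
  obtains Q :: "real \<Rightarrow> int" where "\<And>x. [Q x = r] (mod q)"
    and "((\<lambda>x. Q x / (1 + x\<^sup>2)) \<longlongrightarrow> 1 / c) at_top"
    and "((\<lambda>x. dist_int (x * of_int (Q x) / (1 + x\<^sup>2))) \<longlongrightarrow> 1 / 2) at_top"
proof -
  define T where "T x = (1 + x\<^sup>2) / x * (of_int \<lfloor>x / c\<rfloor> + 1 / 2)" for x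
  have "\<exists>Q::int. [Q = r] (mod q) \<and> T x \<le> Q \<and> Q < T x + q" for x
    using exists_cong_between[OF q_pos] by blast
  then obtain Q :: "real \<Rightarrow> int" where Q_cong: "\<And>x. [Q x = r] (mod q)"
    and Q_between: "\<And>x. T x \<le> Q x" "\<And>x. Q x < T x + q"
    by metis
  define y where "y x = x * of_int (Q x) / (1 + x\<^sup>2) - (of_int \<lfloor>x / c\<rfloor> + 1 / 2)" for x
  have y_eq: "y x = x / (1 + x\<^sup>2) * (Q x - T x)" if "0 < x" for x
  proof -
    have "1 + x\<^sup>2 \<noteq> 0" by (simp add: add_nonneg_eq_0_iff)
    then have "x / (1 + x\<^sup>2) * T x = of_int \<lfloor>x / c\<rfloor> + 1 / 2" using that by (simp add: T_def)
    then show ?thesis by (simp add: y_def right_diff_distrib)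
  qed
  have "(y \<longlongrightarrow> 0) at_top"
  proof (rule real_tendsto_sandwich)
    show "\<forall>\<^sub>F x in at_top. 0 \<le> y x"
      using eventually_gt_at_top[of 0] by eventually_elim (simp add: y_eq Q_between)
    show "\<forall>\<^sub>F x in at_top. y x \<le> x / (1 + x\<^sup>2) * q"
      using eventually_gt_at_top[of 0]
    proof eventually_elim
      case (elim x)
      have "Q x - T x \<le> q" using Q_between(2)[of x] by linarith
      then show ?case unfolding y_eq[OF elim] using elim by (intro mult_left_mono) auto
    qed
    show "((\<lambda>x. x / (1 + x\<^sup>2) * q) \<longlongrightarrow> 0) at_top" by real_asymp
  qed simp
  from limits_if_near_half_integers[OF c_pos this[unfolded y_def]] show ?thesis
    by (rule that[OF Q_cong])
qed

lemma eventually_unique_shortest: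
  fixes Q :: "real \<Rightarrow> real" and c :: real
  assumes c_bounds: "0 < c" "c < 2 / sqrt 3"
    and Q_lim: "((\<lambda>x. Q x / (1 + x\<^sup>2)) \<longlongrightarrow> 1 / c) at_top"
    and dist_lim: "((\<lambda>x. dist_int (x * Q x / (1 + x\<^sup>2))) \<longlongrightarrow> 1 / 2) at_top"
  shows "\<forall>\<^sub>F x in at_top. unique_shortest x (Q x)"
proof -
  have "c\<^sup>2 < (2 / sqrt 3)\<^sup>2" using c_bounds by (intro power_strict_mono) auto
  then have "1 < (1 / 2)\<^sup>2 + (1 / c)\<^sup>2" using c_bounds by (simp add: power_divide field_simps)
  then have "\<forall>\<^sub>F x in at_top. 1 < (dist_int (x * Q x / (1 + x\<^sup>2)))\<^sup>2 + (Q x / (1 + x\<^sup>2))\<^sup>2"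
    by (rule order_tendstoD(1)[rotated]) (intro tendsto_intros dist_lim Q_lim)
  then show ?thesis by eventually_elim (rule unique_shortestI)
qed

lemma eventually_exists_denominator:
  fixes q r :: int and c \<epsilon> \<delta> :: real
  assumes c_bounds: "0 < c" "c < 2 / sqrt 3" and \<epsilon>_pos: "0 < \<epsilon>" and \<delta>_pos: "0 < \<delta>" and q_pos: "0 < q"
  shows "\<forall>\<^sub>F x in at_top. \<exists>Q::int. [Q = r] (mod q) \<and> 0 < Q \<and> unique_shortest x Q \<and>
    c * (1 - \<epsilon>) < (1 + x\<^sup>2) / Q \<and> (1 + x\<^sup>2) / Q < c * (1 + \<epsilon>) \<and> q / Q < \<epsilon> \<and> (1 + x) / Q < \<delta>"
proof -
  obtain Q :: "real \<Rightarrow> int" where Q_cong: "\<And>x. [Q x = r] (mod q)"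
    and Q_lim: "((\<lambda>x. Q x / (1 + x\<^sup>2)) \<longlongrightarrow> 1 / c) at_top"
    and dist_lim: "((\<lambda>x. dist_int (x * of_int (Q x) / (1 + x\<^sup>2))) \<longlongrightarrow> 1 / 2) at_top"
    using exists_cong_denominators[OF q_pos c_bounds(1), where r = r] by blast
  have form_pos: "0 < 1 + x\<^sup>2" for x :: real by (simp add: add_pos_nonneg)
  have quotient_lim: "((\<lambda>x. (1 + x\<^sup>2) / Q x) \<longlongrightarrow> c) at_top"
    using tendsto_inverse[OF Q_lim] c_bounds by (simp add: inverse_eq_divide)
  have div_Q_lim: "((\<lambda>x. f x / Q x) \<longlongrightarrow> 0) at_top"
    if "((\<lambda>x. f x / (1 + x\<^sup>2)) \<longlongrightarrow> 0) at_top" for f :: "real \<Rightarrow> real"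
  proof -
    have "f x / (1 + x\<^sup>2) * ((1 + x\<^sup>2) / Q x) = f x / Q x" for x
      using form_pos[of x] by simp
    then show ?thesis using tendsto_mult[OF that quotient_lim] by (simp only: mult_zero_left)
  qed
  have "\<forall>\<^sub>F x in at_top. unique_shortest x (Q x)"
    using c_bounds Q_lim dist_lim by (rule eventually_unique_shortest)
  moreover have "\<forall>\<^sub>F x in at_top. 0 < Q x / (1 + x\<^sup>2)"
    by (rule order_tendstoD(1)[OF Q_lim]) (use c_bounds in simp)
  then have "\<forall>\<^sub>F x in at_top. 0 < Q x"
    by eventually_elim (metis form_pos zero_less_divide_iff of_int_0_less_iff order.asym)
  moreover have "\<forall>\<^sub>F x in at_top. c * (1 - \<epsilon>) < (1 + x\<^sup>2) / Q x"
    by (rule order_tendstoD(1)[OF quotient_lim]) (use c_bounds \<epsilon>_pos in simp)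
  moreover have "\<forall>\<^sub>F x in at_top. (1 + x\<^sup>2) / Q x < c * (1 + \<epsilon>)"
    by (rule order_tendstoD(2)[OF quotient_lim]) (use c_bounds \<epsilon>_pos in simp)
  moreover have "\<forall>\<^sub>F x in at_top. q / Q x < \<epsilon>"
    by (rule order_tendstoD(2)[OF div_Q_lim \<epsilon>_pos]) real_asymp
  moreover have "\<forall>\<^sub>F x in at_top. (1 + x) / Q x < \<delta>"
    by (rule order_tendstoD(2)[OF div_Q_lim \<delta>_pos]) real_asymp
  ultimately show ?thesis
    by eventually_elim (intro exI conjI, rule Q_cong)
qed

lemma exists_cong_unique_shortest:
  fixes d r :: int and q :: nat and c \<epsilon> \<delta> :: real
  assumes c_bounds: "0 < c" "c < 2 / sqrt 3" and \<epsilon>_pos: "0 < \<epsilon>" and \<delta>_pos: "0 < \<delta>" and q_pos: "0 < q"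
  obtains D :: int and Q :: nat where "[D = d] (mod q)" "[int Q = r] (mod q)" "0 < Q"
    "unique_shortest D Q" "c * (1 - \<epsilon>) < (1 + D\<^sup>2) / Q" "(1 + D\<^sup>2) / Q < c * (1 + \<epsilon>)"
    "q / Q < \<epsilon>" "(1 + \<bar>D\<bar>) / Q < \<delta>" "D \<noteq> 0" "0 < D \<longleftrightarrow> b"
proof -
  define \<sigma> :: int where "\<sigma> = (if b then 1 else - 1)"
  define D where "D n = d + q * (\<sigma> * int n)" for n
  have "filterlim (\<lambda>n. \<sigma> * d + real q * real n) at_top sequentially"
    using q_pos by real_asymp
  moreover have "\<sigma> * d + real q * real n = \<sigma> * D n" for n
    by (simp add: D_def \<sigma>_def)
  ultimately have D_lim: "filterlim (\<lambda>n. real_of_int (\<sigma> * D n)) at_top sequentially" by simp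
  then have D_pos: "\<forall>\<^sub>F n in sequentially. 0 < real_of_int (\<sigma> * D n)"
    by (simp add: filterlim_at_top_dense)
  have "0 < int q" using q_pos by simp
  note Q_exists = eventually_compose_filterlim
    [OF eventually_exists_denominator[OF c_bounds \<epsilon>_pos \<delta>_pos this, where r = r] D_lim]
  from eventually_happens'[OF sequentially_bot eventually_conj[OF D_pos Q_exists]]
  obtain n N where \<sigma>_D_pos: "0 < real_of_int (\<sigma> * D n)" and N_cong: "[N = r] (mod int q)"
    and "0 < N" and N_bounds: "unique_shortest (\<sigma> * D n) N"
    "c * (1 - \<epsilon>) < (1 + (real_of_int (\<sigma> * D n))\<^sup>2) / N"
    "(1 + (real_of_int (\<sigma> * D n))\<^sup>2) / N < c * (1 + \<epsilon>)"
    "real_of_int (int q) / N < \<epsilon>" "(1 + real_of_int (\<sigma> * D n)) / N < \<delta>"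
    by blast
  have abs_D: "\<sigma> * D n = \<bar>D n\<bar>" and D_sign: "D n \<noteq> 0" "0 < D n \<longleftrightarrow> b"
    using \<sigma>_D_pos[unfolded of_int_0_less_iff] by (auto simp: \<sigma>_def split: if_splits)
  obtain Q where N_eq: "N = int Q" and "0 < Q" using zero_less_imp_eq_int[OF \<open>0 < N\<close>] by blast
  note Q_bounds = N_bounds[unfolded abs_D N_eq of_int_abs of_int_of_nat_eq power2_abs]
  show ?thesis
  proof (rule that)
    show "[D n = d] (mod q)" by (simp add: D_def cong_def)
    show "[int Q = r] (mod q)" using N_cong unfolding N_eq .
    show "unique_shortest (D n) Q" using Q_bounds(1) by (rule unique_shortest_abs)
  qed (use \<open>0 < Q\<close> Q_bounds D_sign in simp_all)
qed

subsection \<open>Best approximations\<close>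

lemma approx_err_nonneg: "0 \<le> approx_err v k"
  by (simp add: approx_err_def)

lemma approx_err_sq_le:
  fixes g h :: int
  shows "(approx_err v k)\<^sup>2 \<le> (k * v $ 1 - g)\<^sup>2 + (k * v $ 2 - h)\<^sup>2"
proof -
  have "(approx_err v k)\<^sup>2 = (dist_int (k * v $ 1))\<^sup>2 + (dist_int (k * v $ 2))\<^sup>2"
    by (simp add: approx_err_def)
  also have "\<dots> \<le> (k * v $ 1 - g)\<^sup>2 + (k * v $ 2 - h)\<^sup>2" by (intro add_mono dist_int_sq_le)
  finally show ?thesis .
qed

lemma approx_err_sq_attained:
  obtains g h :: int where "(approx_err v k)\<^sup>2 = (k * v $ 1 - g)\<^sup>2 + (k * v $ 2 - h)\<^sup>2"
  by (rule that[of "round (k * v $ 1)" "round (k * v $ 2)"])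
    (simp add: approx_err_def dist_int_eq_round)

lemma continuous_on_approx_err: "continuous_on S (\<lambda>v. approx_err v k)"
  unfolding approx_err_def by (intro continuous_intros)

lemma exists_approx_err_less:
  assumes "0 < x"
  obtains k where "0 < k" "approx_err v k < x"
proof -
  obtain N :: nat where N_gt: "2 / x < N" using reals_Archimedean2 by blast
  moreover have "0 < 2 / x" using assms by simp
  ultimately have "0 < real N" by linarith
  then have N_bounds: "0 < N" "2 / real N < x" using N_gt assms by (simp_all add: field_simps)
  define \<theta> where "\<theta> i = (if i = 0 then v $ 1 else v $ 2)" for i :: nat
  obtain q p where q_pos: "0 < q" and p_close: "\<And>i. i < 2 \<Longrightarrow> \<bar>of_int q * \<theta> i - of_int (p i)\<bar> < 1 / N"
    using Dirichlet_approx_simult[OF N_bounds(1), of 2 \<theta>] by metis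
  define k where "k = nat q"
  have "0 < k" and k_eq: "real k = of_int q" using q_pos by (simp_all add: k_def)
  have "(k * \<theta> i - p i)\<^sup>2 < (1 / N)\<^sup>2" if "i < 2" for i
    using power_strict_mono[OF p_close[OF that], of 2] k_eq by simp
  from this[of 0] this[of 1]
  have "(k * v $ 1 - p 0)\<^sup>2 < (1 / N)\<^sup>2" "(k * v $ 2 - p 1)\<^sup>2 < (1 / N)\<^sup>2"
    by (simp_all add: \<theta>_def)
  then have "(approx_err v k)\<^sup>2 < (1 / N)\<^sup>2 + (1 / N)\<^sup>2"
    using approx_err_sq_le[of v k "p 0" "p 1"] by linarith
  also have "\<dots> \<le> (2 / N)\<^sup>2" by (simp add: power_divide divide_right_mono)
  finally have "approx_err v k < 2 / N" by (rule power_less_imp_less_base) simp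
  then show ?thesis using that \<open>0 < k\<close> N_bounds(2) by simp
qed

declare best_denom.simps(2) [simp del]

lemma best_denom_Suc_better:
  assumes "better_denoms v (best_denom v n) \<noteq> {}"
  shows "0 < best_denom v (Suc n)"
    and "approx_err v (best_denom v (Suc n)) < approx_err v (best_denom v n)"
proof -
  have "best_denom v (Suc n) \<in> better_denoms v (best_denom v n)"
    using assms unfolding best_denom.simps(2) by (auto intro: LeastI)
  then show "0 < best_denom v (Suc n)"
    and "approx_err v (best_denom v (Suc n)) < approx_err v (best_denom v n)"
    by (simp_all add: better_denoms_def)
qed

lemma approx_err_best_denom_le:
  assumes "0 < k" "k < best_denom v (Suc n)"
  shows "approx_err v (best_denom v n) \<le> approx_err v k"
  using assms not_less_Least[of k "\<lambda>q. q \<in> better_denoms v (best_denom v n)"]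
  by (auto simp: better_denoms_def best_denom.simps(2) not_less)

lemma infinite_best_approx_if_approx_err_pos:
  assumes approx_err_pos: "\<And>k. 0 < k \<Longrightarrow> 0 < approx_err v k"
  shows "infinite_best_approx v"
  unfolding infinite_best_approx_def
proof
  have better: "better_denoms v k \<noteq> {}" if "0 < k" for k
    using exists_approx_err_less[OF approx_err_pos[OF that], of v]
    by (auto simp: better_denoms_def)
  fix n
  show "better_denoms v (best_denom v n) \<noteq> {}"
  proof (induction n)
    case 0
    show ?case by (simp add: better)
  next
    case (Suc n)
    then show ?case by (rule better[OF best_denom_Suc_better(1)])
  qed
qed

lemma strict_mono_best_denom:
  assumes "infinite_best_approx v"
  shows "strict_mono (best_denom v)"
proof (rule strict_monoI_Suc)
  fix n
  let ?a = "best_denom v"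
  have better: "0 < ?a (Suc m)" "approx_err v (?a (Suc m)) < approx_err v (?a m)" for m
    using best_denom_Suc_better assms by (simp_all add: infinite_best_approx_def)
  have "?a (Suc n) \<noteq> ?a n" using better(2)[of n] by auto
  moreover have "?a n \<le> ?a (Suc n)"
  proof (cases n)
    case 0
    then show ?thesis using better(1)[of 0] by simp
  next
    case (Suc m)
    show ?thesis
    proof (rule ccontr)
      assume "\<not> ?thesis"
      then have "approx_err v (?a m) \<le> approx_err v (?a (Suc n))"
        using better(1)[of n] by (intro approx_err_best_denom_le) (simp_all add: Suc)
      then show False using better(2)[of n] better(2)[of m] Suc by simp
    qed
  qed
  ultimately show "?a n < ?a (Suc n)" by linarith
qed

lemma strict_mono_bracket:
  fixes q :: "nat \<Rightarrow> nat" and b :: "'a \<Rightarrow> nat"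
  assumes q_mono: "strict_mono q" and b_gt: "\<And>x. q 0 < b x" and b_lim: "filterlim b at_top F"
  obtains m where "\<And>x. q (m x) < b x" "\<And>x. b x \<le> q (Suc (m x))" "filterlim m at_top F"
proof -
  have "\<exists>n. q n < b x \<and> b x \<le> q (Suc n)" for x
    using ex_least_nat_less[of "\<lambda>n. b x \<le> q n" "b x"] b_gt[of x] seq_suble[OF q_mono]
    by (meson le_refl not_le)
  then obtain m where m_bracket: "\<And>x. q (m x) < b x" "\<And>x. b x \<le> q (Suc (m x))" by metis
  have "\<forall>\<^sub>F x in F. N \<le> m x" for N
    using b_lim[unfolded filterlim_at_top, rule_format, of "Suc (q N)"]
  proof eventually_elim
    case (elim x)
    then have "q N < q (Suc (m x))" using m_bracket(2)[of x] by linarith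
    then show ?case using q_mono by (simp add: strict_mono_less)
  qed
  then have "filterlim m at_top F" by (simp add: filterlim_at_top)
  with m_bracket show ?thesis by (rule that)
qed

text \<open>The exceptional range near \<open>Q\<close> makes room for the mirror image \<open>Q - q\<close> of \<open>q\<close>.\<close>

definition near_minimum :: "real \<Rightarrow> real \<Rightarrow> nat \<Rightarrow> nat \<Rightarrow> real ^ 2 \<Rightarrow> bool" where
  "near_minimum c \<epsilon> q Q v \<longleftrightarrow>
     Q * (approx_err v q)\<^sup>2 \<le> c * (1 + \<epsilon>) \<and>
     (\<forall>k. 0 < k \<and> k < Q \<longrightarrow> c * (1 - \<epsilon>) \<le> Q * (approx_err v k)\<^sup>2) \<and>
     (\<forall>k. 0 < k \<and> k < (1 - \<epsilon>) * Q \<longrightarrow> approx_err v q \<le> approx_err v k)"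

lemma best_denom_bounds_if_near_minimum:
  fixes v :: "real ^ 2"
  defines "a \<equiv> best_denom v"
  assumes infinite: "infinite_best_approx v" and near: "near_minimum c \<epsilon> q Q v" and "\<epsilon> \<le> 1"
    and "0 < q" "q < a (Suc n)" "a (Suc n) \<le> Q"
  shows "c * (1 - \<epsilon>)\<^sup>2 \<le> a (Suc n) * (approx_err v (a n))\<^sup>2"
    and "a (Suc n) * (approx_err v (a n))\<^sup>2 \<le> c * (1 + \<epsilon>)"
proof -
  have "strict_mono a" unfolding a_def by (rule strict_mono_best_denom[OF infinite])
  then have a_less: "a n < a (Suc n)" and "a 0 \<le> a n"
    by (simp_all add: strict_mono_less strict_mono_less_eq)
  then have a_pos: "0 < a n" by (simp add: a_def)
  have err_le: "approx_err v (a n) \<le> approx_err v q"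
    using \<open>0 < q\<close> \<open>q < a (Suc n)\<close> unfolding a_def by (rule approx_err_best_denom_le)
  have "a (Suc n) * (approx_err v (a n))\<^sup>2 \<le> Q * (approx_err v q)\<^sup>2"
    using \<open>a (Suc n) \<le> Q\<close> err_le approx_err_nonneg by (intro mult_mono power_mono) auto
  then show "a (Suc n) * (approx_err v (a n))\<^sup>2 \<le> c * (1 + \<epsilon>)"
    using near by (simp add: near_minimum_def)
  have "approx_err v (a (Suc n)) < approx_err v q"
    using best_denom_Suc_better(2)[of v n] infinite err_le
    by (simp add: infinite_best_approx_def a_def)
  then have a_Suc_ge: "(1 - \<epsilon>) * Q \<le> a (Suc n)"
    using near a_less a_pos unfolding near_minimum_def by (metis less_trans not_le)
  have "c * (1 - \<epsilon>)\<^sup>2 = (1 - \<epsilon>) * (c * (1 - \<epsilon>))" by (simp add: power2_eq_square)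
  also have "\<dots> \<le> (1 - \<epsilon>) * (Q * (approx_err v (a n))\<^sup>2)"
    using near a_less a_pos \<open>a (Suc n) \<le> Q\<close> \<open>\<epsilon> \<le> 1\<close> unfolding near_minimum_def
    by (intro mult_left_mono) auto
  also have "\<dots> \<le> a (Suc n) * (approx_err v (a n))\<^sup>2"
    unfolding mult.assoc[symmetric] using a_Suc_ge by (intro mult_right_mono) auto
  finally show "c * (1 - \<epsilon>)\<^sup>2 \<le> a (Suc n) * (approx_err v (a n))\<^sup>2" .
qed

lemma infinite_best_approx_if_near_minima:
  assumes q_mono: "strict_mono q" and near: "\<And>n. near_minimum (c n) (\<epsilon> n) (q n) (q (Suc n)) v"
    and c_pos: "\<And>n. 0 < c n" and \<epsilon>_less_1: "\<And>n. \<epsilon> n < 1"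
  shows "infinite_best_approx v"
proof (rule infinite_best_approx_if_approx_err_pos)
  fix k :: nat assume "0 < k"
  moreover have "k < q (Suc k)" using seq_suble[OF q_mono, of "Suc k"] by simp
  ultimately have "c k * (1 - \<epsilon> k) \<le> q (Suc k) * (approx_err v k)\<^sup>2"
    using near[of k] by (simp add: near_minimum_def)
  moreover have "0 < c k * (1 - \<epsilon> k)" using c_pos \<epsilon>_less_1 by simp
  ultimately have "approx_err v k \<noteq> 0" by auto
  then show "0 < approx_err v k" using approx_err_nonneg[of v k] by linarith
qed

lemma best_denom_tendsto_if_near_minima:
  assumes q_mono: "strict_mono q" and q_0: "q 0 = 1"
    and near: "\<And>n. near_minimum (c n) (\<epsilon> n) (q n) (q (Suc n)) v"
    and c_pos: "\<And>n. 0 < c n" and \<epsilon>_less_1: "\<And>n. \<epsilon> n < 1"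
    and c_lim: "c \<longlonglongrightarrow> l" and \<epsilon>_lim: "\<epsilon> \<longlonglongrightarrow> 0"
  shows "(\<lambda>n. real (best_denom v (Suc n)) * (approx_err v (best_denom v n))\<^sup>2) \<longlonglongrightarrow> l"
proof -
  let ?a = "best_denom v"
  have infinite: "infinite_best_approx v"
    using q_mono near c_pos \<epsilon>_less_1 by (rule infinite_best_approx_if_near_minima)
  have a_mono: "strict_mono ?a" by (rule strict_mono_best_denom[OF infinite])
  have "q 0 < ?a (Suc n)" for n using strict_monoD[OF a_mono, of 0 "Suc n"] q_0 by simp
  moreover have "filterlim (\<lambda>n. ?a (Suc n)) at_top sequentially"
    using filterlim_subseq[OF a_mono] filterlim_Suc by (rule filterlim_compose)
  ultimately obtain m where m_bracket: "\<And>n. q (m n) < ?a (Suc n)" "\<And>n. ?a (Suc n) \<le> q (Suc (m n))"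
    and m_lim: "filterlim m at_top sequentially"
    using strict_mono_bracket[OF q_mono, of "\<lambda>n. ?a (Suc n)" sequentially] by blast
  have q_pos: "0 < q n" for n using strict_mono_less_eq[OF q_mono, of 0 n] q_0 by simp
  note bounds = best_denom_bounds_if_near_minimum
    [OF infinite near less_imp_le[OF \<epsilon>_less_1] q_pos m_bracket]
  have m_lims: "(\<lambda>n. c (m n)) \<longlonglongrightarrow> l" "(\<lambda>n. \<epsilon> (m n)) \<longlonglongrightarrow> 0"
    using c_lim \<epsilon>_lim m_lim by (auto intro: filterlim_compose)
  have "(\<lambda>n. c (m n) * (1 - \<epsilon> (m n))\<^sup>2) \<longlonglongrightarrow> l * (1 - 0)\<^sup>2"
    by (intro tendsto_intros m_lims)
  then have lower: "(\<lambda>n. c (m n) * (1 - \<epsilon> (m n))\<^sup>2) \<longlonglongrightarrow> l" by simp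
  have "(\<lambda>n. c (m n) * (1 + \<epsilon> (m n))) \<longlonglongrightarrow> l * (1 + 0)"
    by (intro tendsto_intros m_lims)
  then have upper: "(\<lambda>n. c (m n) * (1 + \<epsilon> (m n))) \<longlonglongrightarrow> l" by simp
  show ?thesis
    by (rule tendsto_sandwich[OF _ _ lower upper]) (simp_all add: bounds)
qed

subsection \<open>Approximations of a rational point\<close>

definition rational_point :: "int \<Rightarrow> int \<Rightarrow> nat \<Rightarrow> real ^ 2" where
  "rational_point p P q = vector [p / q, P / q]"

lemma rational_point_nth [simp]:
  "rational_point p P q $ 1 = p / q" "rational_point p P q $ 2 = P / q"
  by (simp_all add: rational_point_def)

lemma combination_less_modulus:
  fixes i t :: int and k q Q :: nat
  assumes k_eq: "int k = i * q + t * Q" and k_pos: "0 < k" and k_less: "k < Q"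
    and q_bounds: "0 < q" "q < Q"
  shows "i \<noteq> 0" and "i = 1 \<Longrightarrow> k = q" and "i = -1 \<Longrightarrow> k = Q - q"
proof -
  have "int k = int k mod Q" using k_less by simp
  also have "\<dots> = (i * q) mod Q" unfolding k_eq by simp
  finally have k_mod: "int k = (i * q) mod Q" .
  show "i \<noteq> 0" and "i = 1 \<Longrightarrow> k = q" using k_mod k_pos q_bounds by auto
  show "k = Q - q" if "i = -1"
    using k_mod q_bounds unfolding that by (simp add: zmod_zminus1_eq_if of_nat_diff)
qed

lemma eventually_nhds_less:
  fixes f g :: "'a::topological_space \<Rightarrow> 'b::linorder_topology"
  assumes "f x < g x" "continuous_on UNIV f" "continuous_on UNIV g"
  shows "\<forall>\<^sub>F y in nhds x. f y < g y"
  using assms by (auto intro: eventually_nhds_in_open[OF open_Collect_less, simplified])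

locale unimodular_step =
  fixes p P p' P' D :: int and q Q :: nat
  assumes det_fst: "p' * q - p * Q = 1" and det_snd: "P' * q - P * Q = D"
    and denom_bounds: "0 < q" "q < Q"
begin

abbreviation next_point :: "real ^ 2" where
  "next_point \<equiv> rational_point p' P' Q"

lemma Q_pos: "0 < real Q"
  using denom_bounds by simp

lemma of_int_det:
  "real_of_int p' * q - real_of_int p * Q = 1" "real_of_int P' * q - real_of_int P * Q = D"
  using det_fst[THEN arg_cong[where f = real_of_int]] det_snd[THEN arg_cong[where f = real_of_int]]
  by simp_all

lemma next_point_diff_nth:
  "next_point $ 1 - rational_point p P q $ 1 = 1 / (q * Q)"
  "next_point $ 2 - rational_point p P q $ 2 = D / (q * Q)"
  using of_int_det denom_bounds Q_pos by (simp_all add: field_simps)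

lemma dist_next_point_le: "dist (rational_point p P q) next_point \<le> (1 + \<bar>D\<bar>) / (q * Q)"
proof -
  have "dist (rational_point p P q) next_point \<le>
      \<bar>next_point $ 1 - rational_point p P q $ 1\<bar> + \<bar>next_point $ 2 - rational_point p P q $ 2\<bar>"
    using norm_le_l1_cart[of "next_point - rational_point p P q"]
    by (simp add: dist_norm sum_2 norm_minus_commute)
  also have "\<dots> = (1 + \<bar>D\<bar>) / (q * Q)"
    unfolding next_point_diff_nth by (simp add: abs_divide add_divide_distrib)
  finally show ?thesis .
qed

lemma eventually_snd_greater_iff:
  assumes "D \<noteq> 0"
  shows "\<forall>\<^sub>F v in nhds next_point. rational_point p P q $ 2 < v $ 2 \<longleftrightarrow> 0 < D"
proof -
  have snd_lim: "((\<lambda>v. v $ 2) \<longlongrightarrow> next_point $ 2) (nhds next_point)"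
    by (intro tendsto_vec_nth filterlim_ident)
  have denom_pos: "0 < real q * real Q" using denom_bounds by simp
  consider (pos) "0 < D" | (neg) "D < 0" using assms by linarith
  then show ?thesis
  proof cases
    case pos
    then have "rational_point p P q $ 2 < next_point $ 2"
      using next_point_diff_nth(2) divide_pos_pos[OF _ denom_pos, of D] by simp
    from order_tendstoD(1)[OF snd_lim this] show ?thesis by eventually_elim (use pos in simp)
  next
    case neg
    then have "next_point $ 2 < rational_point p P q $ 2"
      using next_point_diff_nth(2) divide_neg_pos[OF _ denom_pos, of D] by simp
    from order_tendstoD(2)[OF snd_lim this] show ?thesis by eventually_elim (use neg in simp)
  qed
qed

lemma approx_err_next_point_le: "(Q * approx_err next_point q)\<^sup>2 \<le> 1 + D\<^sup>2"
proof -
  have "Q * (q * next_point $ 1 - p) = 1" "Q * (q * next_point $ 2 - P) = D"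
    using Q_pos of_int_det by (simp_all add: field_simps)
  moreover have "(Q * approx_err next_point q)\<^sup>2 \<le>
      (Q * (q * next_point $ 1 - p))\<^sup>2 + (Q * (q * next_point $ 2 - P))\<^sup>2"
    unfolding power_mult_distrib distrib_left[symmetric]
    by (intro mult_left_mono approx_err_sq_le) simp
  ultimately show ?thesis by simp
qed

lemma approx_err_next_point_attained:
  obtains i j t :: int where "int k = i * q + t * Q"
    and "(Q * approx_err next_point k)\<^sup>2 =
      (real_of_int i)\<^sup>2 + (real_of_int i * D + real_of_int j * Q)\<^sup>2"
proof -
  obtain g h :: int where err_eq: "(approx_err next_point k)\<^sup>2 =
      (k * next_point $ 1 - g)\<^sup>2 + (k * next_point $ 2 - h)\<^sup>2"
    by (rule approx_err_sq_attained)
  define i where "i = k * p' - g * Q"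
  define t where "t = g * q - k * p"
  define j where "j = i * P + t * P' - h"
  have "i * q + t * Q = k * (p' * q - p * Q)" unfolding i_def t_def by (simp add: algebra_simps)
  then have k_eq: "int k = i * q + t * Q" using det_fst by simp
  have "k * P' - h * Q = i * D + j * Q"
    unfolding k_eq j_def det_snd[symmetric] by (simp add: algebra_simps)
  then have "real_of_int (k * P' - h * Q) = real_of_int i * D + real_of_int j * Q"
    by (simp only: of_int_add of_int_mult of_int_of_nat_eq)
  moreover have "Q * (k * next_point $ 1 - g) = of_int (k * p' - g * Q)"
    "Q * (k * next_point $ 2 - h) = of_int (k * P' - h * Q)"
    using Q_pos by (simp_all add: field_simps)
  ultimately have "Q * (k * next_point $ 1 - g) = of_int i"
    "Q * (k * next_point $ 2 - h) = real_of_int i * D + real_of_int j * Q"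
    by (simp_all only: i_def)
  moreover have "(Q * approx_err next_point k)\<^sup>2 =
      (Q * (k * next_point $ 1 - g))\<^sup>2 + (Q * (k * next_point $ 2 - h))\<^sup>2"
    by (simp only: power_mult_distrib err_eq distrib_left)
  ultimately have "(Q * approx_err next_point k)\<^sup>2 =
      (real_of_int i)\<^sup>2 + (real_of_int i * D + real_of_int j * Q)\<^sup>2"
    by (simp only:)
  with k_eq show ?thesis by (rule that)
qed

end

locale shortest_step = unimodular_step +
  assumes shortest: "unique_shortest D Q"
begin

lemma approx_err_next_point_bounds:
  assumes "0 < k" "k < Q"
  shows "1 + D\<^sup>2 \<le> (Q * approx_err next_point k)\<^sup>2"
    and "k \<notin> {q, Q - q} \<Longrightarrow> 1 + D\<^sup>2 < (Q * approx_err next_point k)\<^sup>2"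
proof -
  obtain i j t :: int where k_eq: "int k = i * q + t * Q"
    and err_eq: "(Q * approx_err next_point k)\<^sup>2 =
      (real_of_int i)\<^sup>2 + (real_of_int i * D + real_of_int j * Q)\<^sup>2"
    by (rule approx_err_next_point_attained)
  note i_cases = combination_less_modulus[OF k_eq assms denom_bounds]
  have err_greater: "1 + D\<^sup>2 < (Q * approx_err next_point k)\<^sup>2"
    if "(i, j) \<notin> {(0, 0), (1, 0), (-1, 0)}"
    using shortest that unfolding unique_shortest_def err_eq by simp
  show "1 + D\<^sup>2 \<le> (Q * approx_err next_point k)\<^sup>2"
  proof (cases "(i, j) \<in> {(1, 0), (-1, 0)}")
    case True
    then show ?thesis unfolding err_eq by auto
  next
    case False
    then show ?thesis using i_cases(1) by (intro less_imp_le err_greater) auto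
  qed
  show "1 + D\<^sup>2 < (Q * approx_err next_point k)\<^sup>2" if "k \<notin> {q, Q - q}"
    using that i_cases by (intro err_greater) auto
qed

lemma approx_err_next_point: "(Q * approx_err next_point q)\<^sup>2 = 1 + D\<^sup>2"
  using approx_err_next_point_le approx_err_next_point_bounds(1)[OF denom_bounds] by simp

lemma approx_err_next_point_less:
  assumes "0 < k" "k < Q" "k \<notin> {q, Q - q}"
  shows "approx_err next_point q < approx_err next_point k"
proof -
  have "Q * approx_err next_point q < Q * approx_err next_point k"
    using approx_err_next_point_bounds(2)[OF assms] unfolding approx_err_next_point[symmetric]
    by (rule power_less_imp_less_base) (simp add: approx_err_nonneg)
  then show ?thesis using Q_pos by simp
qed

lemma eventually_near_minimum:
  assumes q_small: "q / Q < \<epsilon>"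
    and c_bounds: "c * (1 - \<epsilon>) < (1 + D\<^sup>2) / Q" "(1 + D\<^sup>2) / Q < c * (1 + \<epsilon>)"
  shows "\<forall>\<^sub>F v in nhds next_point. near_minimum c \<epsilon> q Q v"
proof -
  have err_sq: "Q * (approx_err next_point k)\<^sup>2 = (Q * approx_err next_point k)\<^sup>2 / Q" for k
    using Q_pos by (simp add: power2_eq_square)
  have continuous: "continuous_on UNIV (\<lambda>v. Q * (approx_err v k)\<^sup>2)" for k
    by (intro continuous_intros continuous_on_approx_err)
  have "\<forall>\<^sub>F v in nhds next_point. Q * (approx_err v q)\<^sup>2 < c * (1 + \<epsilon>)"
    by (rule eventually_nhds_less[OF _ continuous continuous_on_const])
      (unfold err_sq approx_err_next_point, rule c_bounds(2))
  moreover have "\<forall>\<^sub>F v in nhds next_point. \<forall>k\<in>{0<..<Q}. c * (1 - \<epsilon>) < Q * (approx_err v k)\<^sup>2"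
  proof (intro eventually_ball_finite ballI)
    fix k assume "k \<in> {0<..<Q}"
    then have "(1 + D\<^sup>2) / Q \<le> Q * (approx_err next_point k)\<^sup>2"
      unfolding err_sq by (intro divide_right_mono approx_err_next_point_bounds) auto
    then have "c * (1 - \<epsilon>) < Q * (approx_err next_point k)\<^sup>2" using c_bounds(1) by linarith
    then show "\<forall>\<^sub>F v in nhds next_point. c * (1 - \<epsilon>) < Q * (approx_err v k)\<^sup>2"
      by (rule eventually_nhds_less[OF _ continuous_on_const continuous])
  qed simp
  moreover have "\<forall>\<^sub>F v in nhds next_point. \<forall>k\<in>{0<..<Q} - {q, Q - q}. approx_err v q < approx_err v k"
    by (intro eventually_ball_finite ballI eventually_nhds_less approx_err_next_point_less
        continuous_on_approx_err) auto
  ultimately show ?thesis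
  proof eventually_elim
    case (elim v)
    have "approx_err v q \<le> approx_err v k" if "0 < k" "k < (1 - \<epsilon>) * Q" for k
    proof (cases "k = q")
      case False
      have "q < \<epsilon> * Q" using q_small Q_pos by (simp add: field_simps)
      then have "real k + q < Q" using that(2) by (simp add: algebra_simps)
      then have "k < Q" "k \<noteq> Q - q" by linarith+
      then show ?thesis using elim(3) False that(1) by (auto simp: less_imp_le)
    qed simp
    then show ?case using elim(1,2) by (auto simp: near_minimum_def less_imp_le)
  qed
qed

end

lemma exists_shortest_step:
  fixes p P :: int and q :: nat and c \<epsilon> \<delta> :: real
  assumes c_bounds: "0 < c" "c < 2 / sqrt 3" and \<epsilon>_bounds: "0 < \<epsilon>" "\<epsilon> < 1" and \<delta>_pos: "0 < \<delta>"
    and q_pos: "0 < q" and coprime: "coprime p q"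
  obtains p' P' D :: int and Q :: nat where "shortest_step p P p' P' D q Q" "q / Q < \<epsilon>"
    "c * (1 - \<epsilon>) < (1 + D\<^sup>2) / Q" "(1 + D\<^sup>2) / Q < c * (1 + \<epsilon>)" "(1 + \<bar>D\<bar>) / Q < \<delta>"
    "D \<noteq> 0" "0 < D \<longleftrightarrow> b"
proof -
  obtain u v where "u * p + v * int q = 1"
    using bezout_int coprime by (metis coprime_imp_gcd_eq_1)
  then have bezout: "v * q - p * (- u) = 1" by (simp add: algebra_simps)
  \<comment> \<open>These residue classes are forced by the integrality of \<open>p'\<close> and \<open>P'\<close>.\<close>
  obtain D :: int and Q :: nat where D_cong: "[D = - P * (- u)] (mod q)"
    and Q_cong: "[int Q = - u] (mod q)" and "0 < Q" and shortest: "unique_shortest D Q"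
    and form_bounds: "c * (1 - \<epsilon>) < (1 + D\<^sup>2) / Q" "(1 + D\<^sup>2) / Q < c * (1 + \<epsilon>)"
    and q_small: "q / Q < \<epsilon>" and D_small: "(1 + \<bar>D\<bar>) / Q < \<delta>" and D_sign: "D \<noteq> 0" "0 < D \<longleftrightarrow> b"
    by (rule exists_cong_unique_shortest[OF c_bounds \<epsilon>_bounds(1) \<delta>_pos q_pos])
  obtain x :: int where Q_eq: "int Q = - u + q * x"
    using cong_sym[OF Q_cong] unfolding cong_iff_lin by blast
  obtain y :: int where D_eq: "D = - P * (- u) + q * y"
    using cong_sym[OF D_cong] unfolding cong_iff_lin by blast
  have "real q < \<epsilon> * Q" using q_small \<open>0 < Q\<close> by (simp add: field_simps)
  also have "\<dots> < Q" using \<epsilon>_bounds(2) \<open>0 < Q\<close> by simp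
  finally have "q < Q" by simp
  have "shortest_step p P (v + p * x) (y + P * x) D q Q"
  proof unfold_locales
    have "(v + p * x) * q - p * Q = v * q - p * (- u)" unfolding Q_eq by (simp add: algebra_simps)
    with bezout show "(v + p * x) * q - p * Q = 1" by simp
    show "(y + P * x) * q - P * Q = D" unfolding Q_eq D_eq by (simp add: algebra_simps)
  qed (fact q_pos \<open>q < Q\<close> shortest)+
  then show ?thesis using q_small form_bounds D_small D_sign by (rule that)
qed

subsection \<open>Cells around rational points\<close>

datatype cell = Cell (num_fst: int) (num_snd: int) (den: nat) (rad: real)

definition cell_center :: "cell \<Rightarrow> real ^ 2" where
  "cell_center s = rational_point (num_fst s) (num_snd s) (den s)"

definition cell_region :: "cell \<Rightarrow> (real ^ 2) set" where
  "cell_region s = cball (cell_center s) (rad s)"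

definition valid_cell :: "cell \<Rightarrow> bool" where
  "valid_cell s \<longleftrightarrow> 0 < den s \<and> coprime (num_fst s) (den s) \<and> 0 < rad s"

definition initial_cell :: cell where
  "initial_cell = Cell 0 0 1 1"

definition cell_refines :: "real \<Rightarrow> real \<Rightarrow> bool \<Rightarrow> cell \<Rightarrow> cell \<Rightarrow> bool" where
  "cell_refines c \<epsilon> b s t \<longleftrightarrow> cell_region t \<subseteq> cell_region s \<and> den s < den t \<and>
     (\<forall>v\<in>cell_region t. near_minimum c \<epsilon> (den s) (den t) v \<and> (cell_center s $ 2 < v $ 2 \<longleftrightarrow> b))"

lemma exists_cell_refinement:
  assumes c_bounds: "0 < c" "c < 2 / sqrt 3" and \<epsilon>_bounds: "0 < \<epsilon>" "\<epsilon> < 1" and "valid_cell s"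
  shows "\<exists>t. valid_cell t \<and> cell_refines c \<epsilon> b s t"
proof -
  let ?p = "num_fst s" and ?P = "num_snd s" and ?q = "den s"
  have s_valid: "0 < rad s * ?q" "0 < ?q" "coprime ?p ?q"
    using \<open>valid_cell s\<close> by (simp_all add: valid_cell_def)
  obtain p' P' D :: int and Q :: nat where step: "shortest_step ?p ?P p' P' D ?q Q"
    and near: "?q / Q < \<epsilon>" "c * (1 - \<epsilon>) < (1 + D\<^sup>2) / Q" "(1 + D\<^sup>2) / Q < c * (1 + \<epsilon>)"
    and D_small: "(1 + \<bar>D\<bar>) / Q < rad s * ?q" and D_sign: "D \<noteq> 0" "0 < D \<longleftrightarrow> b"
    by (rule exists_shortest_step[OF c_bounds \<epsilon>_bounds s_valid])
  interpret shortest_step ?p ?P p' P' D ?q Q by (fact step)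
  have "(1 + \<bar>D\<bar>) / (?q * Q) < rad s" using D_small denom_bounds Q_pos by (simp add: field_simps)
  then have "next_point \<in> ball (cell_center s) (rad s)"
    using dist_next_point_le by (simp add: cell_center_def)
  then have "\<forall>\<^sub>F v in nhds next_point. v \<in> ball (cell_center s) (rad s)"
    by (intro eventually_nhds_in_open) auto
  moreover have "\<forall>\<^sub>F v in nhds next_point. near_minimum c \<epsilon> ?q Q v"
    using near by (rule eventually_near_minimum)
  moreover have "\<forall>\<^sub>F v in nhds next_point. cell_center s $ 2 < v $ 2 \<longleftrightarrow> b"
    using eventually_snd_greater_iff[OF D_sign(1)] unfolding D_sign(2) cell_center_def .
  ultimately have "\<forall>\<^sub>F v in nhds next_point. v \<in> ball (cell_center s) (rad s) \<and>
      near_minimum c \<epsilon> ?q Q v \<and> (cell_center s $ 2 < v $ 2 \<longleftrightarrow> b)"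
    by eventually_elim simp
  then obtain r where "0 < r" and r_ball: "\<And>v. v \<in> cball next_point r \<Longrightarrow>
      v \<in> ball (cell_center s) (rad s) \<and> near_minimum c \<epsilon> ?q Q v \<and> (cell_center s $ 2 < v $ 2 \<longleftrightarrow> b)"
    unfolding eventually_nhds_metric_le by (auto simp: dist_commute)
  define t where "t = Cell p' P' Q r"
  have t_region: "cell_region t = cball next_point r"
    by (simp add: t_def cell_region_def cell_center_def)
  have "coprime p' Q" using det_fst by (metis coprimeI dvd_diff dvd_mult dvd_mult2)
  then have "valid_cell t" using \<open>0 < r\<close> denom_bounds by (simp add: valid_cell_def t_def)
  moreover have "cell_region t \<subseteq> cell_region s"
    using r_ball ball_subset_cball unfolding t_region cell_region_def[of s] by blast
  then have "cell_refines c \<epsilon> b s t"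
    using r_ball denom_bounds(2) unfolding cell_refines_def t_region by (simp add: t_def)
  ultimately show ?thesis by blast
qed

lemma Cantor_scheme_cells:
  fixes c \<epsilon> :: "nat \<Rightarrow> real"
  assumes "\<And>n. 0 < c n" "\<And>n. c n < 2 / sqrt 3" "\<And>n. 0 < \<epsilon> n" "\<And>n. \<epsilon> n < 1"
  shows "Cantor_scheme valid_cell cell_region (\<lambda>n. cell_refines (c n) (\<epsilon> n)) initial_cell"
proof
  show "valid_cell initial_cell" by (simp add: initial_cell_def valid_cell_def)
  show "\<exists>t. valid_cell t \<and> cell_refines (c n) (\<epsilon> n) b s t" if "valid_cell s" for s n b
    using assms that by (intro exists_cell_refinement)
  show "compact (cell_region s)" and "cell_region s \<noteq> {}" if "valid_cell s" for s
    using that by (simp_all add: cell_region_def valid_cell_def)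
qed (auto simp: cell_refines_def)

lemma eqpoll_reals_near_minima:
  fixes c \<epsilon> :: "nat \<Rightarrow> real"
  assumes "\<And>n. 0 < c n" "\<And>n. c n < 2 / sqrt 3" "\<And>n. 0 < \<epsilon> n" "\<And>n. \<epsilon> n < 1"
  shows "\<exists>S :: (real ^ 2) set. S \<approx> (UNIV :: real set) \<and> (\<forall>v\<in>S.
    \<exists>q. strict_mono q \<and> q 0 = 1 \<and> (\<forall>n. near_minimum (c n) (\<epsilon> n) (q n) (q (Suc n)) v))"
proof -
  interpret Cantor_scheme valid_cell cell_region "\<lambda>n. cell_refines (c n) (\<epsilon> n)" initial_cell
    using assms by (rule Cantor_scheme_cells)
  have "\<exists>q. strict_mono q \<and> q 0 = 1 \<and>
      (\<forall>n. near_minimum (c n) (\<epsilon> n) (q n) (q (Suc n)) (branch_point A))" for A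
  proof (intro exI conjI allI)
    let ?q = "\<lambda>n. den (branch A n)"
    show "strict_mono ?q"
      using branch_refines by (simp add: strict_mono_Suc_iff cell_refines_def del: branch.simps)
    show "?q 0 = 1" unfolding branch.simps by (simp add: initial_cell_def)
    show "near_minimum (c n) (\<epsilon> n) (?q n) (?q (Suc n)) (branch_point A)" for n
      using branch_refines[of n A] branch_point_mem[of A "Suc n"] unfolding cell_refines_def by blast
  qed
  then show ?thesis using range_branch_point_eqpoll by blast
qed

theorem theorem2:
  fixes l :: real
  assumes "l \<in> {0 .. 2 / sqrt 3}"
  shows "\<exists>S :: (real ^ 2) set. S \<approx> (UNIV :: real set) \<and>
    (\<forall>v\<in>S. infinite_best_approx v \<and>
       (\<forall>p. best_numerators v p \<longrightarrow>
          (\<lambda>n. 1 / pi * cyl_volume v p (n + 1)) \<longlonglongrightarrow> l \<and>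
          (\<lambda>n. real (best_denom v (n + 1)) * (best_dist v p n)\<^sup>2) \<longlonglongrightarrow> l))"
proof -
  have "l \<in> closure {0<..<2 / sqrt 3}" and "(0::real) \<in> closure {0<..<1}" using assms by simp_all
  then obtain c \<epsilon> where c_bounds: "\<And>n. 0 < c n" "\<And>n. c n < 2 / sqrt 3" and c_lim: "c \<longlonglongrightarrow> l"
    and \<epsilon>_bounds: "\<And>n. 0 < \<epsilon> n" "\<And>n. \<epsilon> n < 1" and \<epsilon>_lim: "\<epsilon> \<longlonglongrightarrow> (0::real)"
    unfolding closure_sequential by auto
  obtain S :: "(real ^ 2) set" where S_card: "S \<approx> (UNIV :: real set)" and S_near: "\<forall>v\<in>S.
      \<exists>q. strict_mono q \<and> q 0 = 1 \<and> (\<forall>n. near_minimum (c n) (\<epsilon> n) (q n) (q (Suc n)) v)"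
    using eqpoll_reals_near_minima[where c = c and \<epsilon> = \<epsilon>, OF c_bounds \<epsilon>_bounds] by blast
  show ?thesis
  proof (intro exI[of _ S] conjI ballI allI impI)
    fix v assume "v \<in> S"
    then obtain q where q_mono: "strict_mono q" and q_0: "q 0 = 1"
      and near: "\<And>n. near_minimum (c n) (\<epsilon> n) (q n) (q (Suc n)) v"
      using S_near by blast
    show "infinite_best_approx v"
      using q_mono near c_bounds(1) \<epsilon>_bounds(2) by (rule infinite_best_approx_if_near_minima)
    fix p assume numerators: "best_numerators v p"
    show "(\<lambda>n. real (best_denom v (n + 1)) * (best_dist v p n)\<^sup>2) \<longlonglongrightarrow> l"
      using best_denom_tendsto_if_near_minima[OF q_mono q_0 near c_bounds(1) \<epsilon>_bounds(2) c_lim \<epsilon>_lim]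
      by (simp add: best_dist_eq_approx_err[OF numerators])
    then show "(\<lambda>n. 1 / pi * cyl_volume v p (n + 1)) \<longlonglongrightarrow> l"
      by (simp add: cyl_volume_def cyl_radius_def)
  qed (fact S_card)
qed

end
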